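(* Let $0<k<1$. There is a constant $C$ depending only on $k$ such that for every $k$-quasiregular harmonic complex-valued function $f$ on the unit disk $\mathbb D$ which has a continuous extension to $\overline{\mathbb D}$, $$\tilde\omega(f,\delta)\le C\,\omega(f,\delta)\qquad\text{for all }\delta\ge0.$$
   Context: $\mathbb D=\{z\in\mathbb C:|z|<1\}$. A complex-valued harmonic function $f$ on $\mathbb D$ is $k$-quasiregular if $|\bar\partial f(z)|\le k|\partial f(z)|$ for all $z\in\mathbb D$, where $\bar\partial f=\frac12(\partial_xf+i\partial_yf)$ and $\partial f=\frac12(\partial_xf-i\partial_yf)$. For $f$ continuous on $\overline{\mathbb D}$ and $\delta\ge0$, $$\omega(f,\delta)=\sup\{|f(e^{i\theta})-f(e^{it})|:|e^{i\theta}-e^{it}|\le\delta,\ t,\theta\in\mathbb R\},$$ $$\tilde\omega(f,\delta)=\sup\{|f(z)-f(w)|:|z-w|\le\delta,\ z,w\in\overline{\mathbb D}\}.$$ *)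

theory Defs
  imports "HOL-Analysis.Analysis"
begin

text \<open>The plane is identified with the complex numbers, \<open>z = x + \<i> y\<close>; functions are total on
  \<^typ>\<open>complex\<close>, and only their values on the set in question matter.\<close>

definition partial_x :: "(complex \<Rightarrow> complex) \<Rightarrow> complex \<Rightarrow> complex" where
  "partial_x f z = vector_derivative (\<lambda>t::real. f (z + of_real t)) (at 0)"

definition partial_y :: "(complex \<Rightarrow> complex) \<Rightarrow> complex \<Rightarrow> complex" where
  "partial_y f z = vector_derivative (\<lambda>t::real. f (z + \<i> * of_real t)) (at 0)"

definition wirtinger_d :: "(complex \<Rightarrow> complex) \<Rightarrow> complex \<Rightarrow> complex" where
  "wirtinger_d f z = (1/2) * (partial_x f z - \<i> * partial_y f z)"

definition wirtinger_dbar :: "(complex \<Rightarrow> complex) \<Rightarrow> complex \<Rightarrow> complex" where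
  "wirtinger_dbar f z = (1/2) * (partial_x f z + \<i> * partial_y f z)"

text \<open>Below, \<^term>\<open>f differentiable (at z)\<close> is real (Frechet) differentiability, and \<open>U\<close> is meant
  to be open.\<close>

definition C1_on :: "complex set \<Rightarrow> (complex \<Rightarrow> complex) \<Rightarrow> bool" where
  "C1_on U f \<longleftrightarrow> (\<forall>z\<in>U. f differentiable (at z)) \<and>
     continuous_on U (partial_x f) \<and> continuous_on U (partial_y f)"

definition C2_on :: "complex set \<Rightarrow> (complex \<Rightarrow> complex) \<Rightarrow> bool" where
  "C2_on U f \<longleftrightarrow> C1_on U f \<and> C1_on U (partial_x f) \<and> C1_on U (partial_y f)"

definition harmonic_on :: "complex set \<Rightarrow> (complex \<Rightarrow> complex) \<Rightarrow> bool" where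
  "harmonic_on U f \<longleftrightarrow> C2_on U f \<and>
     (\<forall>z\<in>U. partial_x (partial_x f) z + partial_y (partial_y f) z = 0)"

definition quasiregular_harmonic_on :: "complex set \<Rightarrow> real \<Rightarrow> (complex \<Rightarrow> complex) \<Rightarrow> bool" where
  "quasiregular_harmonic_on U k f \<longleftrightarrow> harmonic_on U f \<and>
     (\<forall>z\<in>U. cmod (wirtinger_dbar f z) \<le> k * cmod (wirtinger_d f z))"

text \<open>For \<open>f\<close> continuous on the closed unit disk and \<open>\<delta> \<ge> 0\<close>, the following real suprema are taken
  over nonempty bounded sets.\<close>

definition boundary_modulus :: "(complex \<Rightarrow> complex) \<Rightarrow> real \<Rightarrow> real" where
  "boundary_modulus f \<delta> =
     Sup {cmod (f (cis \<theta>) - f (cis t)) | \<theta> t. cmod (cis \<theta> - cis t) \<le> \<delta>}"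

definition disk_modulus :: "(complex \<Rightarrow> complex) \<Rightarrow> real \<Rightarrow> real" where
  "disk_modulus f \<delta> =
     Sup {cmod (f z - f w) | z w. z \<in> cball 0 1 \<and> w \<in> cball 0 1 \<and> cmod (z - w) \<le> \<delta>}"

end

theory Submission
  imports Defs
begin

text \<open>With \<open>p = 4k/(1+k)\<^sup>2 < 1\<close>, the function \<open>|f - c|\<^sup>p\<close> is subharmonic away from its zeros
  for every \<open>k\<close>-quasiregular harmonic \<open>f\<close> and constant \<open>c\<close>. On the unit circle the modulus of
  continuity grows at most linearly, so \<open>|f(w) - f(\<zeta>)|\<^sup>p\<close> is there at most a multiple of
  \<open>\<omega>(f,\<delta>)\<^sup>p (1 + 2|w - \<zeta>|/\<delta>)\<^sup>p\<close>. Since \<open>p < 1\<close>, this is dominated by a multiple of the harmonic function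
  \<open>Re (1 + 2(1 - w \<zeta>\<^sup>*)/\<delta>)\<^sup>p\<close>, where \<open>\<zeta>\<^sup>*\<close> is the conjugate of \<open>\<zeta>\<close>, and the maximum principle gives
  \<open>|f(z) - f(\<zeta>)| \<le> C \<omega>(f,\<delta>) (1 + 2|z - \<zeta>|/\<delta>)\<close> in the disk. Through a nearest
  boundary point this settles pairs \<open>z, w\<close> with \<open>|z| \<ge> 1 - \<delta>\<close>; the remaining ones follow from the
  maximum principle for the harmonic function \<open>v \<mapsto> f(v + h) - f(v)\<close>, \<open>|h| \<le> \<delta>\<close>, on the disk of radius
  \<open>1 - \<delta>\<close>.\<close>

section \<open>Second derivatives and a maximum principle\<close>

text \<open>A relation between \<open>g\<close> and the value \<open>D\<close>: \<open>g\<close> is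
  differentiable near 0, its derivative once more at 0 itself. Nothing is asked away from 0, so the
  notion suits functions that are smooth only near a given point.\<close>

definition has_second_derivative0 :: "(real \<Rightarrow> real) \<Rightarrow> real \<Rightarrow> bool" where
  "has_second_derivative0 g D \<longleftrightarrow>
     (\<exists>g'. (\<forall>\<^sub>F t in nhds 0. (g has_real_derivative g' t) (at t)) \<and>
           (g' has_real_derivative D) (at 0))"

lemma has_second_derivative0I:
  assumes "\<forall>\<^sub>F t in nhds 0. (g has_real_derivative g' t) (at t)"
    and "(g' has_real_derivative D) (at 0)"
  shows "has_second_derivative0 g D"
  unfolding has_second_derivative0_def by (intro exI[of _ g'] conjI assms)

lemma has_second_derivative0_add:
  assumes "has_second_derivative0 g D" "has_second_derivative0 h E"
  shows "has_second_derivative0 (\<lambda>t. g t + h t) (D + E)"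
proof -
  obtain g' h' where
    g: "\<forall>\<^sub>F t in nhds 0. (g has_real_derivative g' t) (at t)" "(g' has_real_derivative D) (at 0)"
    and h: "\<forall>\<^sub>F t in nhds 0. (h has_real_derivative h' t) (at t)" "(h' has_real_derivative E) (at 0)"
    using assms unfolding has_second_derivative0_def by blast
  have "\<forall>\<^sub>F t in nhds 0. ((\<lambda>t. g t + h t) has_real_derivative g' t + h' t) (at t)"
    using g(1) h(1) by eventually_elim (rule DERIV_add)
  moreover have "((\<lambda>t. g' t + h' t) has_real_derivative D + E) (at 0)"
    using g(2) h(2) by (rule DERIV_add)
  ultimately show ?thesis by (rule has_second_derivative0I)
qed

lemma has_second_derivative0_cmult:
  assumes "has_second_derivative0 g D"
  shows "has_second_derivative0 (\<lambda>t. c * g t) (c * D)"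
proof -
  obtain g' where
    g: "\<forall>\<^sub>F t in nhds 0. (g has_real_derivative g' t) (at t)" "(g' has_real_derivative D) (at 0)"
    using assms unfolding has_second_derivative0_def by blast
  have "\<forall>\<^sub>F t in nhds 0. ((\<lambda>t. c * g t) has_real_derivative c * g' t) (at t)"
    using g(1) by eventually_elim (rule DERIV_cmult)
  moreover have "((\<lambda>t. c * g' t) has_real_derivative c * D) (at 0)"
    using g(2) by (rule DERIV_cmult)
  ultimately show ?thesis by (rule has_second_derivative0I)
qed

lemma has_second_derivative0_const: "has_second_derivative0 (\<lambda>t. c) 0"
proof (rule has_second_derivative0I)
  show "\<forall>\<^sub>F t in nhds 0. ((\<lambda>t. c) has_real_derivative 0) (at t)"
    by (rule always_eventually) (rule allI, rule DERIV_const)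
qed (rule DERIV_const)

text \<open>The second derivative test. At a local maximum \<open>g' 0 = 0\<close>; if
  \<open>D\<close> were positive, \<open>g'\<close> would be positive just to the right of 0, and
  the mean value theorem would make \<open>g\<close> exceed \<open>g 0\<close> there.\<close>

lemma has_second_derivative0_local_max:
  assumes "has_second_derivative0 g D" and max: "\<forall>\<^sub>F t in nhds 0. g t \<le> g 0"
  shows "D \<le> 0"
proof (rule ccontr)
  assume "\<not> D \<le> 0"
  obtain g' where
    g: "\<forall>\<^sub>F t in nhds 0. (g has_real_derivative g' t) (at t)" "(g' has_real_derivative D) (at 0)"
    using assms unfolding has_second_derivative0_def by blast
  have "\<forall>\<^sub>F t in nhds 0. (g has_real_derivative g' t) (at t) \<and> g t \<le> g 0"
    using g(1) max by eventually_elim auto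
  then obtain d where d: "d > 0"
    "\<And>t. \<bar>t\<bar> < d \<Longrightarrow> (g has_real_derivative g' t) (at t) \<and> g t \<le> g 0"
    unfolding eventually_nhds_metric by (auto simp: dist_real_def)
  have g0: "g' 0 = 0"
    by (rule DERIV_local_max[of g _ 0 d]) (use d in auto)
  obtain e where e: "e > 0" "\<And>h. 0 < h \<Longrightarrow> h < e \<Longrightarrow> g' 0 < g' (0 + h)"
    using DERIV_pos_inc_right[OF g(2)] \<open>\<not> D \<le> 0\<close> by auto
  define b where "b = min d e / 2"
  have b: "0 < b" "b < d" "b < e" using d(1) e(1) by (auto simp: b_def)
  have "\<exists>z>0. z < b \<and> g b - g 0 = (b - 0) * g' z"
    by (rule MVT2) (use b d(2) in auto)
  then obtain z where z: "0 < z" "z < b" "g b - g 0 = b * g' z" by auto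
  have "g' z > 0" using e(2)[of z] g0 z b by auto
  then have "g b > g 0" using z b by (smt (verit) mult_pos_pos)
  then show False using d(2)[of b] b by auto
qed

text \<open>A pointwise stand-in for subharmonicity. Being tied to one point, it can be demanded
  only where the function is positive, which keeps clear of the zeros at which a power of a modulus
  is not smooth.\<close>

definition laplacian_nonneg_at :: "(complex \<Rightarrow> real) \<Rightarrow> complex \<Rightarrow> bool" where
  "laplacian_nonneg_at \<phi> z \<longleftrightarrow>
     (\<exists>X Y. has_second_derivative0 (\<lambda>t. \<phi> (z + of_real t)) X \<and>
            has_second_derivative0 (\<lambda>t. \<phi> (z + \<i> * of_real t)) Y \<and> 0 \<le> X + Y)"

lemma eventually_line_in_open:
  fixes S :: "complex set"
  assumes "open S" "z \<in> S"
  shows "\<forall>\<^sub>F t in nhds (0::real). z + d * of_real t \<in> S"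
proof (rule topological_tendstoD[OF _ assms(1)])
  have "isCont (\<lambda>t. z + d * of_real t) 0" by (intro continuous_intros)
  then show "((\<lambda>t. z + d * of_real t) \<longlongrightarrow> z) (nhds 0)"
    using tendsto_at_iff_tendsto_nhds[of "\<lambda>t. z + d * of_real t" 0] by (simp add: isCont_def)
qed (use assms in auto)

text \<open>The term \<open>e * (norm w)\<^sup>2\<close> contributes \<open>4 * e\<close> to the
  Laplacian, so the Laplacian of the sum is strictly positive, whereas at a maximum neither of its
  second derivatives along the axes can be positive.\<close>

lemma laplacian_nonneg_at_not_strict_max:
  assumes L: "laplacian_nonneg_at \<phi> z" and S: "open S" "z \<in> S" and e: "e > 0"
    and max: "\<And>w. w \<in> S \<Longrightarrow> \<phi> w + e * (norm w)\<^sup>2 \<le> \<phi> z + e * (norm z)\<^sup>2"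
  shows False
proof -
  obtain X Y where X: "has_second_derivative0 (\<lambda>t. \<phi> (z + of_real t)) X"
    and Y: "has_second_derivative0 (\<lambda>t. \<phi> (z + \<i> * of_real t)) Y" and XY: "0 \<le> X + Y"
    using L unfolding laplacian_nonneg_at_def by blast
  have sq: "has_second_derivative0 (\<lambda>t. (norm (z + d * of_real t))\<^sup>2) 2" if "norm d = 1" for d
  proof -
    have eq: "(norm (z + d * of_real t))\<^sup>2 = (norm z)\<^sup>2 + 2 * (z \<bullet> d) * t + t\<^sup>2" for t
    proof -
      have "(norm (z + d * of_real t))\<^sup>2 =
          (norm z)\<^sup>2 + 2 * (z \<bullet> d) * t + ((Re d)\<^sup>2 + (Im d)\<^sup>2) * t\<^sup>2"
        unfolding cmod_power2 inner_complex_def by (simp add: power2_eq_square algebra_simps)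
      then show ?thesis using that by (simp add: cmod_power2[symmetric])
    qed
    show ?thesis unfolding eq has_second_derivative0_def
      by (rule exI[of _ "\<lambda>t. 2 * (z \<bullet> d) + 2 * t"])
        (auto intro!: derivative_eq_intros always_eventually)
  qed
  have test: "D + e * 2 \<le> 0"
    if "norm d = 1" "has_second_derivative0 (\<lambda>t. \<phi> (z + d * of_real t)) D" for d D
  proof (rule has_second_derivative0_local_max)
    show "has_second_derivative0
        (\<lambda>t. \<phi> (z + d * of_real t) + e * (norm (z + d * of_real t))\<^sup>2) (D + e * 2)"
      by (intro has_second_derivative0_add has_second_derivative0_cmult sq that)
    show "\<forall>\<^sub>F t in nhds 0. \<phi> (z + d * of_real t) + e * (norm (z + d * of_real t))\<^sup>2
        \<le> \<phi> (z + d * of_real 0) + e * (norm (z + d * of_real 0))\<^sup>2"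
      using eventually_line_in_open[OF S, of d]
      by eventually_elim (use max in auto)
  qed
  show False using test[of 1 X] test[of \<i> Y] X Y XY e by auto
qed

text \<open>If \<phi> were positive somewhere, a small multiple of \<open>(norm w)\<^sup>2\<close>
  could be added so that the sum still attains its maximum at an interior point where \<phi> is
  positive. This is why the Laplacian condition is asked only at such points.\<close>

theorem maximum_principle:
  fixes \<phi> :: "complex \<Rightarrow> real"
  assumes S: "bounded S" "open S" and cont: "continuous_on (closure S) \<phi>"
    and bd: "\<And>z. z \<in> frontier S \<Longrightarrow> \<phi> z \<le> 0"
    and L: "\<And>z. z \<in> S \<Longrightarrow> \<phi> z > 0 \<Longrightarrow> laplacian_nonneg_at \<phi> z"
    and z: "z \<in> closure S"
  shows "\<phi> z \<le> 0"
proof (rule ccontr)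
  assume neg: "\<not> \<phi> z \<le> 0"
  have "bounded (closure S)" using S by auto
  then obtain N where N: "N > 0" "\<And>w. w \<in> closure S \<Longrightarrow> norm w \<le> N"
    using bounded_pos by blast
  \<comment> \<open>With this choice \<open>e * N\<^sup>2\<close> is half of
    \<open>\<phi> z\<close>, so the perturbation alone cannot reach the maximum of \<open>G\<close>,
    and \<phi> must be positive at the maximum point.\<close>
  define e where "e = \<phi> z / (2 * N\<^sup>2)"
  have e: "e > 0" "e * N\<^sup>2 < \<phi> z" using neg N(1) by (auto simp: e_def field_simps)
  define G where "G = (\<lambda>w. \<phi> w + e * (norm w)\<^sup>2)"
  have "continuous_on (closure S) G" unfolding G_def by (intro continuous_intros cont)
  moreover have "compact (closure S)" using S(1) by (simp only: compact_closure)
  moreover have "closure S \<noteq> {}" using z by auto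
  ultimately have "\<exists>m\<in>closure S. \<forall>w\<in>closure S. G w \<le> G m"
    by (intro continuous_attains_sup)
  then obtain m where m: "m \<in> closure S" "\<And>w. w \<in> closure S \<Longrightarrow> G w \<le> G m"
    by auto
  have le: "e * (norm w)\<^sup>2 \<le> e * N\<^sup>2" if "w \<in> closure S" for w
    using N(2)[OF that] e by (simp add: power_mono)
  have "0 \<le> e * (norm z)\<^sup>2" using e by simp
  then have "e * N\<^sup>2 < G z" using e unfolding G_def by linarith
  then have pos: "\<phi> m > 0" using m(2)[OF z] le[OF m(1)] by (simp add: G_def)
  then have "m \<notin> frontier S" using bd[of m] by auto
  then have mS: "m \<in> S" using m(1) interior_open[OF S(2)] unfolding frontier_def by blast
  show False
  proof (rule laplacian_nonneg_at_not_strict_max[OF L[OF mS pos] S(2) mS e(1)])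
    fix w assume "w \<in> S"
    then have "w \<in> closure S" using closure_subset by blast
    then show "\<phi> w + e * (norm w)\<^sup>2 \<le> \<phi> m + e * (norm m)\<^sup>2"
      using m(2) unfolding G_def by blast
  qed
qed

lemma laplacian_nonneg_at_add:
  assumes "laplacian_nonneg_at \<phi> z" "laplacian_nonneg_at \<psi> z"
  shows "laplacian_nonneg_at (\<lambda>w. \<phi> w + \<psi> w) z"
proof -
  obtain X Y X' Y' where *: "has_second_derivative0 (\<lambda>t. \<phi> (z + of_real t)) X"
    "has_second_derivative0 (\<lambda>t. \<phi> (z + \<i> * of_real t)) Y" "0 \<le> X + Y"
    "has_second_derivative0 (\<lambda>t. \<psi> (z + of_real t)) X'"
    "has_second_derivative0 (\<lambda>t. \<psi> (z + \<i> * of_real t)) Y'" "0 \<le> X' + Y'"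
    using assms unfolding laplacian_nonneg_at_def by blast
  have "0 \<le> (X + X') + (Y + Y')" using * by simp
  then show ?thesis unfolding laplacian_nonneg_at_def
    using has_second_derivative0_add[OF *(1,4)] has_second_derivative0_add[OF *(2,5)] by blast
qed

lemma laplacian_nonneg_at_const: "laplacian_nonneg_at (\<lambda>w. c) z"
  unfolding laplacian_nonneg_at_def
  using has_second_derivative0_const[of c] by (intro exI[of _ 0]) simp

text \<open>Along a direction \<open>d\<close> the second derivative of \<open>F\<close> is
  \<open>d\<^sup>2 * D\<close>; the directions 1 and \<open>\<i>\<close> give opposite values, so
  the Laplacian vanishes. The sign of \<open>c\<close> is therefore free, and a barrier may be
  subtracted.\<close>

lemma laplacian_nonneg_at_cmult_Re:
  assumes S: "open S" "z \<in> S"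
    and F: "\<And>w. w \<in> S \<Longrightarrow> (F has_field_derivative F' w) (at w)"
    and F': "(F' has_field_derivative D) (at z)"
  shows "laplacian_nonneg_at (\<lambda>w. c * Re (F w)) z"
proof -
  have chain: "((\<lambda>t. Re (G (z + d * of_real t))) has_real_derivative Re (d * E)) (at t)"
    if "(G has_field_derivative E) (at (z + d * of_real t))" for G E d t
  proof -
    have *: "((\<lambda>t. z + d * of_real t) has_vector_derivative d) (at t)"
      by (auto intro!: derivative_eq_intros)
    show ?thesis
      using field_vector_diff_chain_at[OF * that]
      by (intro has_field_derivative_Re) (simp add: o_def mult.commute)
  qed
  have "has_second_derivative0 (\<lambda>t. Re (F (z + d * of_real t))) (Re (d * (d * D)))" for d
  proof (rule has_second_derivative0I)
    show "\<forall>\<^sub>F t in nhds 0. ((\<lambda>t. Re (F (z + d * of_real t))) has_real_derivative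
        Re (d * F' (z + d * of_real t))) (at t)"
      using eventually_line_in_open[OF S, of d] by eventually_elim (intro chain F)
    have "((\<lambda>w. d * F' w) has_field_derivative d * D) (at (z + d * of_real 0))"
      using F' by (simp add: DERIV_cmult)
    then show "((\<lambda>t. Re (d * F' (z + d * of_real t))) has_real_derivative Re (d * (d * D))) (at 0)"
      by (rule chain)
  qed
  from has_second_derivative0_cmult[OF this[of 1], of c]
    has_second_derivative0_cmult[OF this[of \<i>], of c]
  show ?thesis unfolding laplacian_nonneg_at_def
    by (intro exI[of _ "c * Re D"] exI[of _ "- (c * Re D)"]) simp
qed

section \<open>Powers of the modulus of a harmonic map\<close>

text \<open>The chain rule for \<open>U powr q\<close> with \<open>U = g \<bullet> g\<close>. The
  formula is \<open>q * u powr (q - 2) * (u * U'' - (1 - q) * U'\<^sup>2)\<close>, where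
  \<open>U' = 2 * (g \<bullet> g')\<close> and \<open>U''\<close> is the first inner sum; the common
  power is pulled out so that only the bracket decides the sign.\<close>

lemma has_second_derivative0_norm_powr:
  fixes g g' :: "real \<Rightarrow> complex"
  assumes g: "\<forall>\<^sub>F t in nhds 0. (g has_vector_derivative g' t) (at t)"
    and g': "(g' has_vector_derivative D) (at 0)" and nz: "g 0 \<noteq> 0"
  defines "u \<equiv> (norm (g 0))\<^sup>2"
  shows "has_second_derivative0 (\<lambda>t. ((norm (g t))\<^sup>2) powr q)
    (q * u powr (q - 2) * (u * (2 * (norm (g' 0))\<^sup>2 + 2 * (g 0 \<bullet> D))
       - (1 - q) * (4 * (g 0 \<bullet> g' 0)\<^sup>2)))"
proof -
  define U where "U = (\<lambda>t. g t \<bullet> g t)"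
  define U' where "U' = (\<lambda>t. 2 * (g t \<bullet> g' t))"
  have U: "(U has_real_derivative U' t) (at t)" if "(g has_vector_derivative g' t) (at t)" for t
  proof -
    have "(U has_derivative (\<lambda>h. g t \<bullet> (h *\<^sub>R g' t) + (h *\<^sub>R g' t) \<bullet> g t)) (at t)"
      unfolding U_def using that unfolding has_vector_derivative_def
      by (intro derivative_intros)
    then show ?thesis unfolding has_field_derivative_def U'_def
      by (rule has_derivative_eq_rhs) (auto simp: inner_commute)
  qed
  have g0: "(g has_vector_derivative g' 0) (at 0)"
    using eventually_nhds_x_imp_x[OF g] .
  have U': "(U' has_real_derivative 2 * (g 0 \<bullet> D) + 2 * (norm (g' 0))\<^sup>2) (at 0)"
  proof -
    have "(U' has_derivative (\<lambda>h. 2 * (g 0 \<bullet> (h *\<^sub>R D) + (h *\<^sub>R g' 0) \<bullet> g' 0))) (at 0)"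
      unfolding U'_def using g0 g' unfolding has_vector_derivative_def
      by (intro derivative_intros)
    then show ?thesis unfolding has_field_derivative_def
      by (rule has_derivative_eq_rhs) (auto simp: power2_norm_eq_inner algebra_simps)
  qed
  have u: "u = U 0" "u > 0" using nz by (auto simp: u_def U_def power2_norm_eq_inner)
  have "continuous (at 0) U" using U[OF g0] DERIV_isCont by blast
  then have "(U \<longlongrightarrow> u) (nhds 0)"
    unfolding u(1) isCont_def by (simp add: tendsto_at_iff_tendsto_nhds)
  then have pos: "\<forall>\<^sub>F t in nhds 0. U t > 0" using u(2) by (rule order_tendstoD)
  have "\<forall>\<^sub>F t in nhds 0.
      ((\<lambda>t. U t powr q) has_real_derivative q * U t powr (q - 1) * U' t) (at t)"
    using g pos
  proof eventually_elim
    case (elim t)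
    show ?case by (rule DERIV_chain2[OF has_real_derivative_powr[OF elim(2)] U[OF elim(1)]])
  qed
  moreover have "((\<lambda>t. q * U t powr (q - 1) * U' t) has_real_derivative
      q * ((q - 1) * U 0 powr (q - 1 - 1) * U' 0) * U' 0
        + (2 * (g 0 \<bullet> D) + 2 * (norm (g' 0))\<^sup>2) * (q * U 0 powr (q - 1))) (at 0)"
  proof (rule DERIV_mult[OF DERIV_cmult U'])
    have "U 0 > 0" using u by simp
    from DERIV_chain2[OF has_real_derivative_powr[OF this] U[OF g0]]
    show "((\<lambda>t. U t powr (q - 1)) has_real_derivative (q - 1) * U 0 powr (q - 1 - 1) * U' 0) (at 0)" .
  qed
  moreover have "U 0 powr (q - 1) = U 0 powr (q - 2) * u"
    using u powr_add[of "U 0" "q - 2" 1] by (simp add: add.commute)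
  then have "q * ((q - 1) * U 0 powr (q - 1 - 1) * U' 0) * U' 0
        + (2 * (g 0 \<bullet> D) + 2 * (norm (g' 0))\<^sup>2) * (q * U 0 powr (q - 1)) =
      q * u powr (q - 2) * (u * (2 * (norm (g' 0))\<^sup>2 + 2 * (g 0 \<bullet> D))
       - (1 - q) * (4 * (g 0 \<bullet> g' 0)\<^sup>2))"
    unfolding u(1)[symmetric] by (simp add: U'_def algebra_simps power2_eq_square)
  ultimately have "has_second_derivative0 (\<lambda>t. U t powr q)
      (q * u powr (q - 2) * (u * (2 * (norm (g' 0))\<^sup>2 + 2 * (g 0 \<bullet> D))
       - (1 - q) * (4 * (g 0 \<bullet> g' 0)\<^sup>2)))"
    by (intro has_second_derivative0I[where g' = "\<lambda>t. q * U t powr (q - 1) * U' t"]) simp_all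
  then show ?thesis by (simp add: U_def power2_norm_eq_inner)
qed

section \<open>Derivatives along the coordinate axes and pointwise harmonicity\<close>

lemma differentiable_has_directional_derivative:
  fixes f :: "complex \<Rightarrow> complex"
  assumes "f differentiable (at (z + d * of_real t))"
  shows "((\<lambda>t. f (z + d * of_real t)) has_vector_derivative
    vector_derivative (\<lambda>s. f (z + d * of_real t + d * of_real s)) (at 0)) (at t)"
proof -
  have "(\<lambda>s. f (z + d * of_real t + d * of_real s)) differentiable (at (0::real))"
  proof (rule differentiable_compose[of f])
    show "f differentiable (at (z + d * of_real t + d * of_real 0))" using assms by simp
    have "((\<lambda>s. z + d * of_real t + d * of_real s) has_derivative (\<lambda>s. d * of_real s)) (at 0)"
      by (auto intro!: derivative_eq_intros)
    then show "(\<lambda>s. z + d * of_real t + d * of_real s) differentiable (at (0::real))"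
      unfolding differentiable_def by blast
  qed
  then have "((\<lambda>s. f (z + d * of_real t + d * of_real s)) has_vector_derivative
      vector_derivative (\<lambda>s. f (z + d * of_real t + d * of_real s)) (at 0)) (at 0)"
    using vector_derivative_works by blast
  \<comment> \<open>The base point 0 is written as \<open>t - t\<close> so that the chain rule with
    the shift \<open>r - t\<close> carries the derivative from 0 to \<open>t\<close>.\<close>
  then have *: "((\<lambda>s. f (z + d * of_real t + d * of_real s)) has_derivative
      (\<lambda>x. x *\<^sub>R vector_derivative (\<lambda>s. f (z + d * of_real t + d * of_real s)) (at 0)))
      (at (t - t))"
    by (simp add: has_vector_derivative_def)
  have "((\<lambda>r. r - t) has_derivative (\<lambda>x. x)) (at t)"
    by (auto intro!: derivative_eq_intros)
  from has_derivative_compose[OF this *]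
  show ?thesis by (simp add: has_vector_derivative_def algebra_simps)
qed

lemma differentiable_has_partial_x:
  assumes "f differentiable (at (z + of_real t))"
  shows "((\<lambda>t. f (z + of_real t)) has_vector_derivative partial_x f (z + of_real t)) (at t)"
  using differentiable_has_directional_derivative[of f z 1 t] assms by (simp add: partial_x_def)

lemma differentiable_has_partial_y:
  assumes "f differentiable (at (z + \<i> * of_real t))"
  shows "((\<lambda>t. f (z + \<i> * of_real t)) has_vector_derivative
    partial_y f (z + \<i> * of_real t)) (at t)"
  using differentiable_has_directional_derivative[of f z \<i> t] assms by (simp add: partial_y_def)

text \<open>\<open>a\<close> and \<open>b\<close> are the values at \<open>z\<close> of the two partial derivatives.\<close>

definition harmonic_at :: "(complex \<Rightarrow> complex) \<Rightarrow> complex \<Rightarrow> complex \<Rightarrow> complex \<Rightarrow> bool" where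
  "harmonic_at f z a b \<longleftrightarrow>
     (\<exists>gx gy X. (\<forall>\<^sub>F t in nhds 0. ((\<lambda>t. f (z + of_real t)) has_vector_derivative gx t) (at t)) \<and>
        (gx has_vector_derivative X) (at 0) \<and> gx 0 = a \<and>
        (\<forall>\<^sub>F t in nhds 0. ((\<lambda>t. f (z + \<i> * of_real t)) has_vector_derivative gy t) (at t)) \<and>
        (gy has_vector_derivative - X) (at 0) \<and> gy 0 = b)"

lemma harmonic_atI:
  assumes "\<forall>\<^sub>F t in nhds 0. ((\<lambda>t. f (z + of_real t)) has_vector_derivative gx t) (at t)"
    and "(gx has_vector_derivative X) (at 0)" and "gx 0 = a"
    and "\<forall>\<^sub>F t in nhds 0. ((\<lambda>t. f (z + \<i> * of_real t)) has_vector_derivative gy t) (at t)"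
    and "(gy has_vector_derivative - X) (at 0)" and "gy 0 = b"
  shows "harmonic_at f z a b"
  unfolding harmonic_at_def by (intro exI[of _ gx] exI[of _ gy] exI[of _ X] conjI assms)

text \<open>Laplace's equation says that the second derivative along the imaginary axis is minus the
  one along the real axis; hence the single vector \<open>X\<close> in
  \<open>harmonic_at\<close>.\<close>

lemma harmonic_on_imp_harmonic_at:
  assumes f: "harmonic_on S f" and S: "open S" "z \<in> S"
  shows "harmonic_at f z (partial_x f z) (partial_y f z)"
proof (rule harmonic_atI)
  have d: "f differentiable (at w)" "partial_x f differentiable (at w)"
    "partial_y f differentiable (at w)" if "w \<in> S" for w
    using f that unfolding harmonic_on_def C2_on_def C1_on_def by auto
  show "\<forall>\<^sub>F t in nhds 0. ((\<lambda>t. f (z + of_real t)) has_vector_derivative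
      partial_x f (z + of_real t)) (at t)"
    using eventually_line_in_open[OF S, of 1]
    by eventually_elim (use d(1) in \<open>auto intro: differentiable_has_partial_x\<close>)
  show "\<forall>\<^sub>F t in nhds 0. ((\<lambda>t. f (z + \<i> * of_real t)) has_vector_derivative
      partial_y f (z + \<i> * of_real t)) (at t)"
    using eventually_line_in_open[OF S, of \<i>]
    by eventually_elim (use d(1) in \<open>auto intro: differentiable_has_partial_y\<close>)
  show "((\<lambda>t. partial_x f (z + of_real t)) has_vector_derivative
      partial_x (partial_x f) z) (at 0)"
    using differentiable_has_partial_x[of "partial_x f" z 0] d(2)[OF S(2)] by simp
  have "partial_y (partial_y f) z = - partial_x (partial_x f) z"
    using f S(2) unfolding harmonic_on_def by (auto simp: eq_neg_iff_add_eq_0 add.commute)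
  then show "((\<lambda>t. partial_y f (z + \<i> * of_real t)) has_vector_derivative
      - partial_x (partial_x f) z) (at 0)"
    using differentiable_has_partial_y[of "partial_y f" z 0] d(3)[OF S(2)] by simp
qed simp_all

lemma harmonic_at_const: "harmonic_at (\<lambda>w. c) z 0 0"
proof (rule harmonic_atI)
  show "((\<lambda>t::real. 0 :: complex) has_vector_derivative 0) (at 0)" by simp
  show "((\<lambda>t::real. 0 :: complex) has_vector_derivative - 0) (at 0)" by simp
qed (auto intro!: always_eventually)

lemma harmonic_at_diff:
  assumes "harmonic_at f z a b" "harmonic_at g z a' b'"
  shows "harmonic_at (\<lambda>w. f w - g w) z (a - a') (b - b')"
proof -
  obtain fx fy X where f:
    "\<forall>\<^sub>F t in nhds 0. ((\<lambda>t. f (z + of_real t)) has_vector_derivative fx t) (at t)"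
    "(fx has_vector_derivative X) (at 0)" "fx 0 = a"
    "\<forall>\<^sub>F t in nhds 0. ((\<lambda>t. f (z + \<i> * of_real t)) has_vector_derivative fy t) (at t)"
    "(fy has_vector_derivative - X) (at 0)" "fy 0 = b"
    using assms(1) unfolding harmonic_at_def by (elim exE conjE) rule
  obtain gx gy Y where g:
    "\<forall>\<^sub>F t in nhds 0. ((\<lambda>t. g (z + of_real t)) has_vector_derivative gx t) (at t)"
    "(gx has_vector_derivative Y) (at 0)" "gx 0 = a'"
    "\<forall>\<^sub>F t in nhds 0. ((\<lambda>t. g (z + \<i> * of_real t)) has_vector_derivative gy t) (at t)"
    "(gy has_vector_derivative - Y) (at 0)" "gy 0 = b'"
    using assms(2) unfolding harmonic_at_def by (elim exE conjE) rule
  show ?thesis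
  proof (rule harmonic_atI)
    show "\<forall>\<^sub>F t in nhds 0. ((\<lambda>t. f (z + of_real t) - g (z + of_real t)) has_vector_derivative
        fx t - gx t) (at t)"
      using f(1) g(1) by eventually_elim (rule has_vector_derivative_diff)
    show "\<forall>\<^sub>F t in nhds 0. ((\<lambda>t. f (z + \<i> * of_real t) - g (z + \<i> * of_real t))
        has_vector_derivative fy t - gy t) (at t)"
      using f(4) g(4) by eventually_elim (rule has_vector_derivative_diff)
    show "((\<lambda>t. fx t - gx t) has_vector_derivative X - Y) (at 0)"
      by (rule has_vector_derivative_diff) fact+
    show "((\<lambda>t. fy t - gy t) has_vector_derivative - (X - Y)) (at 0)"
      using has_vector_derivative_diff[OF f(5) g(5)] by simp
  qed (use f g in auto)
qed

lemma harmonic_at_translate: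
  assumes "harmonic_at f (z + h) a b"
  shows "harmonic_at (\<lambda>w. f (w + h)) z a b"
  using assms unfolding harmonic_at_def by (simp add: add_ac)

text \<open>When the two second derivatives are added, the terms with \<open>X\<close> and
  \<open>- X\<close> cancel. What is left involves first derivatives only, and the hypothesis
  \<open>le\<close> is exactly its nonnegativity up to the factor
  \<open>2 * q * u powr (q - 2)\<close>.\<close>

lemma laplacian_nonneg_at_norm_powr:
  assumes f: "harmonic_at f z a b" and nz: "f z \<noteq> 0" and q: "0 \<le> q"
    and le: "2 * (1 - q) * ((f z \<bullet> a)\<^sup>2 + (f z \<bullet> b)\<^sup>2) \<le>
      (norm (f z))\<^sup>2 * ((norm a)\<^sup>2 + (norm b)\<^sup>2)"
  shows "laplacian_nonneg_at (\<lambda>w. ((norm (f w))\<^sup>2) powr q) z"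
proof -
  obtain fx fy X where f:
    "\<forall>\<^sub>F t in nhds 0. ((\<lambda>t. f (z + of_real t)) has_vector_derivative fx t) (at t)"
    "(fx has_vector_derivative X) (at 0)" "fx 0 = a"
    "\<forall>\<^sub>F t in nhds 0. ((\<lambda>t. f (z + \<i> * of_real t)) has_vector_derivative fy t) (at t)"
    "(fy has_vector_derivative - X) (at 0)" "fy 0 = b"
    using f unfolding harmonic_at_def by (elim exE conjE) rule
  define u where "u = (norm (f z))\<^sup>2"
  have "has_second_derivative0 (\<lambda>t. ((norm (f (z + of_real t)))\<^sup>2) powr q)
      (q * u powr (q - 2) * (u * (2 * (norm a)\<^sup>2 + 2 * (f z \<bullet> X))
       - (1 - q) * (4 * (f z \<bullet> a)\<^sup>2)))"
    using has_second_derivative0_norm_powr[OF f(1,2), of q] nz f(3) by (simp add: u_def)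
  moreover have "has_second_derivative0 (\<lambda>t. ((norm (f (z + \<i> * of_real t)))\<^sup>2) powr q)
      (q * u powr (q - 2) * (u * (2 * (norm b)\<^sup>2 + 2 * (f z \<bullet> - X))
       - (1 - q) * (4 * (f z \<bullet> b)\<^sup>2)))"
    using has_second_derivative0_norm_powr[OF f(4,5), of q] nz f(6) by (simp add: u_def)
  moreover have "0 \<le> q * u powr (q - 2) * (u * (2 * (norm a)\<^sup>2 + 2 * (f z \<bullet> X))
       - (1 - q) * (4 * (f z \<bullet> a)\<^sup>2)) +
      q * u powr (q - 2) * (u * (2 * (norm b)\<^sup>2 + 2 * (f z \<bullet> - X))
       - (1 - q) * (4 * (f z \<bullet> b)\<^sup>2))" (is "0 \<le> ?R")
  proof -
    have "?R = q * u powr (q - 2) * (2 * (u * ((norm a)\<^sup>2 + (norm b)\<^sup>2)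
        - 2 * (1 - q) * ((f z \<bullet> a)\<^sup>2 + (f z \<bullet> b)\<^sup>2)))"
      by (simp add: algebra_simps)
    also have "\<dots> \<ge> 0" using le q by (simp add: u_def)
    finally show ?thesis .
  qed
  ultimately show ?thesis unfolding laplacian_nonneg_at_def by blast
qed

text \<open>For \<open>A\<close> and \<open>B\<close> the two Wirtinger derivatives,
  \<open>A + B\<close> and \<open>\<i> * (A - B)\<close> are the partial derivatives. The two inner
  products are, up to sign, the real and imaginary parts of
  \<open>cnj v * A + cnj (cnj v * B)\<close>, to which the triangle inequality applies.\<close>

lemma wirtinger_inner_bound:
  fixes v A B :: complex
  shows "(v \<bullet> (A + B))\<^sup>2 + (v \<bullet> (\<i> * (A - B)))\<^sup>2 \<le> (norm v)\<^sup>2 * (norm A + norm B)\<^sup>2"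
proof -
  have "(v \<bullet> (A + B))\<^sup>2 + (v \<bullet> (\<i> * (A - B)))\<^sup>2 = (norm (cnj v * A + cnj (cnj v * B)))\<^sup>2"
    unfolding cmod_power2 inner_complex_def by (simp add: power2_eq_square algebra_simps)
  also have "\<dots> \<le> (norm v * norm A + norm v * norm B)\<^sup>2"
  proof (rule power_mono)
    show "norm (cnj v * A + cnj (cnj v * B)) \<le> norm v * norm A + norm v * norm B"
      using norm_triangle_ineq[of "cnj v * A" "cnj (cnj v * B)"] by (simp add: norm_mult)
  qed simp
  also have "\<dots> = (norm v)\<^sup>2 * (norm A + norm B)\<^sup>2"
    by (simp add: power2_eq_square algebra_simps)
  finally show ?thesis .
qed

text \<open>The ratio of \<open>(a + b)\<^sup>2\<close> to \<open>a\<^sup>2 + b\<^sup>2\<close>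
  grows with \<open>b / a\<close> up to 1, so its worst case is \<open>b = k * a\<close>. There
  equality holds, since the coefficient equals
  \<open>(1 + k\<^sup>2) / (1 + k)\<^sup>2\<close>.\<close>

lemma quasiconformal_exponent_bound:
  fixes a b k :: real
  assumes k: "0 < k" "k < 1" and ab: "0 \<le> a" "0 \<le> b" "b \<le> k * a"
  shows "(1 - 2 * k / (1 + k)\<^sup>2) * (a + b)\<^sup>2 \<le> a\<^sup>2 + b\<^sup>2"
proof -
  have "b \<le> a" using k ab by (smt (verit) mult_left_le_one_le)
  then have "k * b \<le> a" using k ab by (smt (verit) mult_left_le_one_le)
  \<comment> \<open>Twice this product is the difference of the two sides of the next
    inequality.\<close>
  then have "0 \<le> (k * a - b) * (a - k * b)" using ab by simp
  then have "(1 + k\<^sup>2) * (a + b)\<^sup>2 \<le> (a\<^sup>2 + b\<^sup>2) * (1 + k)\<^sup>2"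
    by (simp add: power2_eq_square algebra_simps)
  then have "(1 + k\<^sup>2) * (a + b)\<^sup>2 / (1 + k)\<^sup>2 \<le> a\<^sup>2 + b\<^sup>2"
    using k by (simp add: pos_divide_le_eq)
  moreover have "1 - 2 * k / (1 + k)\<^sup>2 = (1 + k\<^sup>2) / (1 + k)\<^sup>2"
  proof -
    have "(1 + k)\<^sup>2 \<noteq> 0" using k by simp
    then show ?thesis by (simp add: divide_simps) (simp add: power2_eq_square algebra_simps)
  qed
  ultimately show ?thesis by simp
qed

text \<open>The exponent is half of \<open>p\<close> because it acts on the squared norm. The
  required first-order inequality combines the two preceding bounds with the parallelogram law, by
  which the squared norms of the partial derivatives add up to
  \<open>2 * ((norm A)\<^sup>2 + (norm B)\<^sup>2)\<close>.\<close>

lemma quasiregular_laplacian_nonneg_at: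
  assumes f: "quasiregular_harmonic_on S k f" and S: "open S" "z \<in> S" and k: "0 < k" "k < 1"
    and nz: "f z \<noteq> c"
  shows "laplacian_nonneg_at (\<lambda>w. ((norm (f w - c))\<^sup>2) powr (2 * k / (1 + k)\<^sup>2)) z"
proof (rule laplacian_nonneg_at_norm_powr)
  have "harmonic_on S f" using f unfolding quasiregular_harmonic_on_def by blast
  from harmonic_at_diff[OF harmonic_on_imp_harmonic_at[OF this S] harmonic_at_const]
  show "harmonic_at (\<lambda>w. f w - c) z (partial_x f z) (partial_y f z)" by simp
  define A B where AB: "A = wirtinger_d f z" "B = wirtinger_dbar f z"
  define q where "q = 2 * k / (1 + k)\<^sup>2"
  have x: "partial_x f z = A + B"
    by (simp add: AB wirtinger_d_def wirtinger_dbar_def algebra_simps)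
  have y: "partial_y f z = \<i> * (A - B)"
    by (simp add: AB wirtinger_d_def wirtinger_dbar_def algebra_simps)
  have BA: "norm B \<le> k * norm A"
    using f S unfolding AB quasiregular_harmonic_on_def by blast
  have "2 * k \<le> (1 + k)\<^sup>2" using k by (simp add: power2_eq_square algebra_simps)
  then have q1: "q \<le> 1" using k by (simp add: q_def)
  have "2 * (1 - q) * (((f z - c) \<bullet> (A + B))\<^sup>2 + ((f z - c) \<bullet> (\<i> * (A - B)))\<^sup>2)
      \<le> 2 * (1 - q) * ((norm (f z - c))\<^sup>2 * (norm A + norm B)\<^sup>2)"
    using q1 by (intro mult_left_mono wirtinger_inner_bound) auto
  also have "\<dots> = 2 * (norm (f z - c))\<^sup>2 * ((1 - q) * (norm A + norm B)\<^sup>2)"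
    by (simp add: algebra_simps)
  also have "\<dots> \<le> 2 * (norm (f z - c))\<^sup>2 * ((norm A)\<^sup>2 + (norm B)\<^sup>2)"
    unfolding q_def using k BA by (intro mult_left_mono quasiconformal_exponent_bound) auto
  also have "\<dots> = (norm (f z - c))\<^sup>2 * ((norm (A + B))\<^sup>2 + (norm (\<i> * (A - B)))\<^sup>2)"
  proof -
    have "(norm (A + B))\<^sup>2 + (norm (\<i> * (A - B)))\<^sup>2 = 2 * ((norm A)\<^sup>2 + (norm B)\<^sup>2)"
      unfolding cmod_power2 by (simp add: power2_eq_square algebra_simps)
    then show ?thesis by simp
  qed
  finally show "2 * (1 - 2 * k / (1 + k)\<^sup>2) *
      (((f z - c) \<bullet> partial_x f z)\<^sup>2 + ((f z - c) \<bullet> partial_y f z)\<^sup>2)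
    \<le> (norm (f z - c))\<^sup>2 * ((norm (partial_x f z))\<^sup>2 + (norm (partial_y f z))\<^sup>2)"
    unfolding x y q_def .
qed (use k nz in auto)

section \<open>The boundary modulus and the barrier\<close>

lemma boundary_modulus_bound:
  assumes f: "continuous_on (cball 0 1) f" and le: "norm (cis \<theta> - cis t) \<le> \<delta>"
  shows "norm (f (cis \<theta>) - f (cis t)) \<le> boundary_modulus f \<delta>"
  unfolding boundary_modulus_def
proof (rule cSup_upper)
  show "norm (f (cis \<theta>) - f (cis t)) \<in>
      {norm (f (cis \<theta>) - f (cis t)) | \<theta> t. norm (cis \<theta> - cis t) \<le> \<delta>}"
    using le by blast
  have "bounded (f ` cball 0 1)"
    using compact_continuous_image[OF f compact_cball] compact_imp_bounded by blast
  then obtain B where B: "\<And>w. norm w \<le> 1 \<Longrightarrow> norm (f w) \<le> B"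
    unfolding bounded_iff by (metis imageI mem_cball_0)
  have "norm (f (cis \<theta>) - f (cis t)) \<le> B + B" for \<theta> t
    by (rule order_trans[OF norm_triangle_ineq4 add_mono]) (auto intro!: B)
  then show "bdd_above {norm (f (cis \<theta>) - f (cis t)) | \<theta> t. norm (cis \<theta> - cis t) \<le> \<delta>}"
    by (intro bdd_aboveI[of _ "B + B"]) auto
qed

lemma boundary_modulus_nonneg:
  assumes "continuous_on (cball 0 1) f" "0 \<le> \<delta>"
  shows "0 \<le> boundary_modulus f \<delta>"
  using boundary_modulus_bound[OF assms(1), of 0 0 \<delta>] assms(2) by simp

section \<open>Chords and arcs of the unit circle\<close>

lemma norm_cis_minus_one: "norm (cis x - 1) = 2 * \<bar>sin (x / 2)\<bar>"
  using dist_exp_i_1[of x] by (simp add: cis_conv_exp)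

lemma norm_cis_diff_le: "norm (cis a - cis b) \<le> \<bar>a - b\<bar>"
proof -
  have "cis a - cis b = cis b * (cis (a - b) - 1)"
    by (simp add: algebra_simps cis_mult)
  then have "norm (cis a - cis b) = 2 * \<bar>sin ((a - b) / 2)\<bar>"
    by (simp add: norm_mult norm_cis_minus_one)
  then show ?thesis using abs_sin_x_le_abs_x[of "(a - b) / 2"] by simp
qed

text \<open>Up to \<open>pi / 3\<close> the difference \<open>sin x - x / 2\<close> is
  nondecreasing, as its derivative is \<open>cos x - 1 / 2\<close>. Beyond that,
  \<open>sin x\<close> is at least \<open>sqrt 3 / 2\<close>, which exceeds
  \<open>pi / 4\<close>.\<close>

lemma half_le_sin:
  fixes x :: real
  assumes "0 \<le> x" "x \<le> pi / 2"
  shows "x / 2 \<le> sin x"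
proof (cases "x \<le> pi / 3")
  case True
  have "sin 0 - 0 / 2 \<le> sin x - x / 2"
  proof (rule DERIV_nonneg_imp_nondecreasing[OF assms(1)])
    fix y assume y: "0 \<le> y" "y \<le> x"
    have "cos (pi / 3) \<le> cos y"
      using y True pi_gt_zero by (intro cos_monotone_0_pi_le) auto
    then have "0 \<le> cos y - 1 / 2" by (simp add: cos_60)
    moreover have "((\<lambda>y. sin y - y / 2) has_real_derivative cos y - 1 / 2) (at y)"
      by (auto intro!: derivative_eq_intros)
    ultimately show "\<exists>D. ((\<lambda>y. sin y - y / 2) has_real_derivative D) (at y) \<and> 0 \<le> D"
      by blast
  qed
  then show ?thesis by simp
next
  case False
  have "sin (pi / 3) \<le> sin x"
    using False assms pi_gt_zero by (intro sin_monotone_2pi_le) auto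
  moreover have "pi \<le> 2 * sqrt 3"
  proof -
    have "1.7 \<le> sqrt (3::real)" by (rule real_le_rsqrt) (simp add: power2_eq_square)
    then show ?thesis using pi_approx by simp
  qed
  ultimately show ?thesis using assms by (simp add: sin_60)
qed

text \<open>The principal argument of the quotient satisfies
  \<open>\<bar>\<alpha>\<bar> \<le> pi\<close>, so the chord
  \<open>2 * \<bar>sin (\<alpha> / 2)\<bar>\<close> is at least half the arc by
  \<open>half_le_sin\<close>.\<close>

lemma unit_circle_diff_angle:
  assumes "norm \<xi> = 1" "norm \<zeta> = 1"
  obtains t \<alpha> where "\<zeta> = cis t" "\<xi> = cis (t + \<alpha>)" "\<bar>\<alpha>\<bar> \<le> 2 * norm (\<xi> - \<zeta>)"
proof
  define \<alpha> where "\<alpha> = Arg (\<xi> / \<zeta>)"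
  have "norm (\<xi> / \<zeta>) = 1" using assms by (simp add: norm_divide)
  then have \<alpha>: "cis \<alpha> = \<xi> / \<zeta>"
    using rcis_cmod_Arg[of "\<xi> / \<zeta>"] by (simp add: rcis_def \<alpha>_def)
  show \<zeta>: "\<zeta> = cis (Arg \<zeta>)"
    using rcis_cmod_Arg[of \<zeta>] assms by (simp add: rcis_def)
  have z0: "\<zeta> \<noteq> 0" using assms by auto
  have "cis (Arg \<zeta> + \<alpha>) = cis (Arg \<zeta>) * cis \<alpha>" by (simp add: cis_mult)
  then show "\<xi> = cis (Arg \<zeta> + \<alpha>)" using \<zeta> \<alpha> z0 by simp
  have "\<xi> - \<zeta> = \<zeta> * (cis \<alpha> - 1)" using \<alpha> z0 by (simp add: algebra_simps)
  then have n: "norm (\<xi> - \<zeta>) = 2 * \<bar>sin (\<alpha> / 2)\<bar>"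
    using assms by (simp add: norm_mult norm_cis_minus_one)
  have "\<bar>\<alpha>\<bar> \<le> pi" using Arg_bounded[of "\<xi> / \<zeta>"] by (auto simp: \<alpha>_def)
  then have "\<bar>\<alpha>\<bar> / 2 / 2 \<le> sin (\<bar>\<alpha>\<bar> / 2)" by (intro half_le_sin) auto
  moreover have "sin (\<bar>\<alpha>\<bar> / 2) \<le> \<bar>sin (\<alpha> / 2)\<bar>" by (cases "\<alpha> \<ge> 0") auto
  ultimately show "\<bar>\<alpha>\<bar> \<le> 2 * norm (\<xi> - \<zeta>)" using n by linarith
qed

text \<open>The arc between the points is cut into pieces of length at most \<delta>, each costing
  one boundary modulus; the number of pieces is controlled by the chord.\<close>

lemma boundary_modulus_chain:
  assumes f: "continuous_on (cball 0 1) f" and \<delta>: "0 < \<delta>"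
    and u: "norm \<xi> = 1" "norm \<zeta> = 1"
  shows "norm (f \<xi> - f \<zeta>) \<le> boundary_modulus f \<delta> * (1 + 2 * norm (\<xi> - \<zeta>) / \<delta>)"
proof -
  obtain t \<alpha> where t: "\<zeta> = cis t" "\<xi> = cis (t + \<alpha>)" "\<bar>\<alpha>\<bar> \<le> 2 * norm (\<xi> - \<zeta>)"
    using unit_circle_diff_angle[OF u] .
  \<comment> \<open>Floor plus one: positive even when \<alpha> is 0, large enough for pieces of
    length at most \<delta>, and at most \<open>1 + \<bar>\<alpha>\<bar> / \<delta>\<close>.\<close>
  define n where "n = Suc (nat \<lfloor>\<bar>\<alpha>\<bar> / \<delta>\<rfloor>)"
  define g where "g j = f (cis (t + real j * (\<alpha> / n)))" for j
  have "0 \<le> \<lfloor>\<bar>\<alpha>\<bar> / \<delta>\<rfloor>" using \<delta> by simp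
  then have n': "real n = 1 + of_int \<lfloor>\<bar>\<alpha>\<bar> / \<delta>\<rfloor>" by (simp add: n_def)
  then have n: "real n \<le> 1 + \<bar>\<alpha>\<bar> / \<delta>" "\<bar>\<alpha>\<bar> / \<delta> \<le> real n" by linarith+
  have n0: "real n > 0" by (simp add: n_def)
  have small: "\<bar>\<alpha>\<bar> / n \<le> \<delta>" using n(2) n0 \<delta> by (simp add: field_simps)
  have step: "norm (g (Suc j) - g j) \<le> boundary_modulus f \<delta>" for j
    unfolding g_def
  proof (rule boundary_modulus_bound[OF f])
    have "norm (cis (t + real (Suc j) * (\<alpha> / n)) - cis (t + real j * (\<alpha> / n)))
        \<le> \<bar>(t + real (Suc j) * (\<alpha> / n)) - (t + real j * (\<alpha> / n))\<bar>"
      by (rule norm_cis_diff_le)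
    also have "(t + real (Suc j) * (\<alpha> / n)) - (t + real j * (\<alpha> / n)) = \<alpha> / n"
      by (simp add: distrib_right add_divide_distrib)
    also have "\<bar>\<alpha> / n\<bar> \<le> \<delta>" using small by simp
    finally show "norm (cis (t + real (Suc j) * (\<alpha> / n)) - cis (t + real j * (\<alpha> / n))) \<le> \<delta>" .
  qed
  have "f \<xi> - f \<zeta> = (\<Sum>j<n. g (Suc j) - g j)"
    unfolding sum_lessThan_telescope using n0 by (simp add: g_def t)
  also have "norm \<dots> \<le> of_nat (card {..<n}) * boundary_modulus f \<delta>"
    by (rule sum_norm_bound) (rule step)
  also have "\<dots> \<le> boundary_modulus f \<delta> * (1 + 2 * norm (\<xi> - \<zeta>) / \<delta>)"
  proof -
    have "\<bar>\<alpha>\<bar> / \<delta> \<le> 2 * norm (\<xi> - \<zeta>) / \<delta>" using t(3) \<delta> by (simp add: divide_right_mono)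
    then have "real n \<le> 1 + 2 * norm (\<xi> - \<zeta>) / \<delta>" using n(1) by linarith
    from mult_left_mono[OF this boundary_modulus_nonneg[OF f, of \<delta>]] \<delta>
    show ?thesis by (simp add: mult.commute)
  qed
  finally show ?thesis .
qed

text \<open>The argument of \<open>W\<close> is at most \<open>pi / 2\<close> in absolute value, so
  that of its power is at most \<open>p * pi / 2\<close>. For \<open>p < 1\<close> the cosine of
  this angle is positive, and the real part is comparable to the modulus.\<close>

lemma Re_powr_ge:
  assumes W: "Re W > 0" and p: "0 \<le> p" "p \<le> 1"
  shows "cos (p * pi / 2) * norm W powr p \<le> Re (W powr of_real p)"
proof -
  have W0: "W \<noteq> 0" using W by auto
  have I: "\<bar>Im (Ln W)\<bar> \<le> pi / 2" using Re_Ln_pos_lt_imp[OF W] by simp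
  have "W powr of_real p = exp (of_real p * Ln W)" using W0 by (simp add: powr_def)
  then have "Re (W powr of_real p) = exp (p * ln (norm W)) * cos (p * Im (Ln W))"
    using W0 by (simp add: Re_exp)
  also have "exp (p * ln (norm W)) = norm W powr p" using W0 by (simp add: powr_def)
  also have "cos (p * Im (Ln W)) = cos (p * \<bar>Im (Ln W)\<bar>)" by (cases "Im (Ln W) \<ge> 0") auto
  finally have eq: "Re (W powr of_real p) = norm W powr p * cos (p * \<bar>Im (Ln W)\<bar>)" .
  have "p * \<bar>Im (Ln W)\<bar> \<le> p * (pi / 2)" using I p by (intro mult_left_mono) auto
  moreover have "p * (pi / 2) \<le> 1 * pi"
    using p pi_gt_zero by (intro mult_mono) auto
  ultimately have "cos (p * pi / 2) \<le> cos (p * \<bar>Im (Ln W)\<bar>)"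
    using p by (intro cos_monotone_0_pi_le) auto
  then show ?thesis unfolding eq by (simp add: mult.commute mult_left_mono)
qed

lemma interior_boundary_estimate:
  assumes f: "quasiregular_harmonic_on (ball 0 1) k f" and cont: "continuous_on (cball 0 1) f"
    and k: "0 < k" "k < 1" and \<delta>: "0 < \<delta>" and \<zeta>: "norm \<zeta> = 1" and z: "norm z \<le> 1"
  defines "p \<equiv> 4 * k / (1 + k)\<^sup>2"
  shows "norm (f z - f \<zeta>) \<le>
    2 * (1 / cos (p * pi / 2)) powr (1 / p) * boundary_modulus f \<delta> * (1 + 2 * norm (z - \<zeta>) / \<delta>)"
proof -
  define q where "q = 2 * k / (1 + k)\<^sup>2"
  define \<omega> where "\<omega> = boundary_modulus f \<delta>"
  define K where "K = cos (p * pi / 2)"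
  \<comment> \<open>Calibrated for the unit circle: there the p-th power of
    \<open>norm (f w - f \<zeta>)\<close> is at most
    \<open>(2 * \<omega>) powr p * norm (W w) powr p\<close>, and \<open>Re_powr_ge\<close> loses
    the factor \<open>K\<close>.\<close>
  define M where "M = (2 * \<omega>) powr p / K"
  define W where "W w = 1 + of_real (2 / \<delta>) * (1 - w * cnj \<zeta>)" for w
  have pq: "p = 2 * q" by (simp add: p_def q_def)
  \<comment> \<open>The strict inequality gives \<open>p < 1\<close>, hence
    \<open>K > 0\<close>.\<close>
  have "0 < (1 - k)\<^sup>2" using k by simp
  then have "4 * k < (1 + k)\<^sup>2" by (simp add: power2_eq_square algebra_simps)
  then have p: "0 < p" "p < 1" using k by (simp_all add: p_def)
  have \<omega>: "0 \<le> \<omega>" unfolding \<omega>_def using boundary_modulus_nonneg[OF cont] \<delta> by simp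
  have K: "K > 0" unfolding K_def using p pi_gt_zero by (intro cos_gt_zero) auto
  have M: "0 \<le> M" using K by (simp add: M_def)
  have Re1: "0 \<le> Re (1 - w * cnj \<zeta>)" if "norm w \<le> 1" for w
  proof -
    have "Re (w * cnj \<zeta>) \<le> norm (w * cnj \<zeta>)" by (rule complex_Re_le_cmod)
    also have "\<dots> \<le> 1" using that \<zeta> by (simp add: norm_mult)
    finally show ?thesis by simp
  qed
  have ReW: "1 \<le> Re (W w)" if "norm w \<le> 1" for w
    using mult_nonneg_nonneg[OF _ Re1[OF that], of "2 / \<delta>"] \<delta> unfolding W_def by simp
  have dist: "norm (1 - w * cnj \<zeta>) = norm (w - \<zeta>)" for w
  proof -
    have "\<zeta> * cnj \<zeta> = 1" using \<zeta> by (simp add: complex_norm_square[symmetric])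
    then have "1 - w * cnj \<zeta> = (\<zeta> - w) * cnj \<zeta>" by (simp add: algebra_simps)
    then show ?thesis using \<zeta> by (simp add: norm_mult norm_minus_commute)
  qed
  have W_le: "norm (W w) \<le> 1 + 2 * norm (w - \<zeta>) / \<delta>" for w
  proof -
    have "norm (W w) \<le> norm (1::complex) + norm (of_real (2 / \<delta>) * (1 - w * cnj \<zeta>))"
      unfolding W_def by (rule norm_triangle_ineq)
    then show ?thesis using \<delta> by (simp only: norm_mult dist norm_of_real norm_one) simp
  qed
  \<comment> \<open>Since \<open>Re x\<close> is nonnegative, \<open>norm (1 + x)\<close> dominates
    \<open>norm x\<close>; \<open>norm (W w)\<close> also dominates 1, and adding the two bounds
    costs the factor 2.\<close>
  have W_ge: "1 + 2 * norm (w - \<zeta>) / \<delta> \<le> 2 * norm (W w)" if w: "norm w \<le> 1" for w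
  proof -
    define x where "x = of_real (2 / \<delta>) * (1 - w * cnj \<zeta>)"
    have "0 \<le> Re x" using mult_nonneg_nonneg[OF _ Re1[OF w], of "2 / \<delta>"] \<delta> by (simp add: x_def)
    then have "(norm x)\<^sup>2 \<le> (norm (1 + x))\<^sup>2"
      unfolding cmod_power2 by (simp add: power2_eq_square algebra_simps)
    then have "norm x \<le> norm (W w)"
      using power2_le_imp_le[of "norm x" "norm (1 + x)"] by (simp add: W_def x_def)
    moreover have "norm x = 2 * norm (w - \<zeta>) / \<delta>"
      using \<delta> by (simp only: x_def norm_mult dist norm_of_real) simp
    moreover have "1 \<le> norm (W w)" using ReW[OF w] complex_Re_le_cmod[of "W w"] by linarith
    ultimately show ?thesis by linarith
  qed
  have Wpos: "W w \<notin> \<real>\<^sub>\<le>\<^sub>0" if "norm w \<le> 1" for w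
    using ReW[OF that] complex_nonpos_Reals_iff[of "W w"] by auto
  define F where "F w = W w powr of_real p" for w
  define \<phi> where "\<phi> w = ((norm (f w - f \<zeta>))\<^sup>2) powr q + - M * Re (F w)" for w
  have sq: "((norm x)\<^sup>2) powr q = norm x powr p" for x :: complex
    by (simp add: pq powr_powr[symmetric] powr_numeral[symmetric] del: powr_numeral)
  have "\<phi> z \<le> 0"
  proof (rule maximum_principle[of "ball 0 1"])
    have "continuous_on (cball 0 1) W" unfolding W_def by (intro continuous_intros)
    moreover have "0 \<le> Re (W w) \<and> W w \<noteq> 0" if "w \<in> cball 0 1" for w
      using ReW[of w] that by auto
    ultimately have "continuous_on (cball 0 1) F"
      unfolding F_def by (intro continuous_on_powr_complex continuous_on_const) auto
    moreover have "continuous_on (cball 0 1) (\<lambda>w. ((norm (f w - f \<zeta>))\<^sup>2) powr q)"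
      using p(1) pq by (intro continuous_on_powr' continuous_intros cont) auto
    ultimately show "continuous_on (closure (ball 0 1)) \<phi>"
      unfolding \<phi>_def by (auto intro!: continuous_intros)
    show "z \<in> closure (ball 0 1)" using z by simp
  next
    fix w :: complex assume "w \<in> frontier (ball 0 1)"
    then have w: "norm w = 1" by (simp add: dist_norm)
    have "norm (f w - f \<zeta>) \<le> \<omega> * (1 + 2 * norm (w - \<zeta>) / \<delta>)"
      unfolding \<omega>_def by (rule boundary_modulus_chain[OF cont \<delta> w \<zeta>])
    also have "\<dots> \<le> \<omega> * (2 * norm (W w))" using W_ge w \<omega> by (intro mult_left_mono) auto
    finally have "norm (f w - f \<zeta>) powr p \<le> (2 * \<omega> * norm (W w)) powr p"
      using p by (intro powr_mono2) (auto simp: algebra_simps)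
    also have "\<dots> = M * (K * norm (W w) powr p)"
      using \<omega> K by (simp add: powr_mult M_def)
    also have "\<dots> \<le> M * Re (F w)"
      unfolding K_def F_def using M p ReW[of w] w by (intro mult_left_mono Re_powr_ge) auto
    finally show "\<phi> w \<le> 0" by (simp add: \<phi>_def sq)
  next
    fix w :: complex assume w: "w \<in> ball 0 1" and pos: "\<phi> w > 0"
    have w1: "norm w \<le> 1" using w by simp
    \<comment> \<open>At a zero of \<open>f w - f \<zeta>\<close> the first term of \<phi> is
      \<open>0 powr q\<close>, which is 0, so a nonnegative barrier excludes such points wherever
      \<phi> is positive.\<close>
    have "0 \<le> Re (F w)"
    proof -
      have "0 \<le> K * norm (W w) powr p" using K by simp
      also have "\<dots> \<le> Re (F w)"
        unfolding K_def F_def using p ReW[OF w1] by (intro Re_powr_ge) auto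
      finally show ?thesis .
    qed
    then have "0 \<le> M * Re (F w)" using M by simp
    then have "f w \<noteq> f \<zeta>" using pos by (auto simp: \<phi>_def)
    then have 1: "laplacian_nonneg_at (\<lambda>w. ((norm (f w - f \<zeta>))\<^sup>2) powr q) w"
      unfolding q_def using quasiregular_laplacian_nonneg_at[OF f _ w k] by simp
    define c where "c = - of_real (2 / \<delta>) * cnj \<zeta>"
    have W': "(W has_field_derivative c) (at w)" for w
      unfolding W_def c_def using \<delta> by (auto intro!: derivative_eq_intros)
    have F': "((\<lambda>w. W w powr r) has_field_derivative r * W w powr (r - 1) * c) (at w)"
      if "w \<in> ball 0 1" for w and r :: complex
      by (rule DERIV_chain2[OF has_field_derivative_powr W']) (use Wpos that in auto)
    have 2: "laplacian_nonneg_at (\<lambda>w. - M * Re (F w)) w"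
    proof (rule laplacian_nonneg_at_cmult_Re[OF _ w])
      show "(F has_field_derivative of_real p * W w powr (of_real p - 1) * c) (at w)"
        if "w \<in> ball 0 1" for w
        unfolding F_def by (rule F'[OF that])
      show "((\<lambda>w. of_real p * W w powr (of_real p - 1) * c) has_field_derivative
          of_real p * ((of_real p - 1) * W w powr (of_real p - 1 - 1) * c) * c) (at w)"
        by (intro DERIV_cmult_right DERIV_cmult F' w)
    qed simp
    show "laplacian_nonneg_at \<phi> w"
      unfolding \<phi>_def by (rule laplacian_nonneg_at_add[OF 1 2])
  qed simp_all
  then have "norm (f z - f \<zeta>) powr p \<le> M * Re (F z)" by (simp add: \<phi>_def sq)
  also have "\<dots> \<le> M * norm (W z) powr p"
    using M complex_Re_le_cmod[of "F z"]
    by (intro mult_left_mono) (auto simp: F_def norm_powr_real_powr')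
  \<comment> \<open>Rewritten as a p-th power so that p-th roots can be taken by
    monotonicity.\<close>
  also have "\<dots> = (2 * (1 / K) powr (1 / p) * \<omega> * norm (W z)) powr p"
    using \<omega> K p by (simp add: M_def powr_mult powr_powr)
  finally have "norm (f z - f \<zeta>) \<le> 2 * (1 / K) powr (1 / p) * \<omega> * norm (W z)"
    using powr_less_mono2[of p "2 * (1 / K) powr (1 / p) * \<omega> * norm (W z)" "norm (f z - f \<zeta>)"] p \<omega>
    by (meson leD leI mult_nonneg_nonneg norm_ge_zero powr_ge_zero zero_le_numeral)
  also have "\<dots> \<le> 2 * (1 / K) powr (1 / p) * \<omega> * (1 + 2 * norm (z - \<zeta>) / \<delta>)"
    using W_le \<omega> by (intro mult_left_mono) auto
  finally show ?thesis by (simp add: K_def \<omega>_def)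
qed

section \<open>The disk modulus\<close>

text \<open>Some boundary point lies within \<delta> of \<open>z\<close>, hence within
  \<open>2 * \<delta>\<close> of \<open>w\<close>. The linear growth factor is then at most 3 and 5
  respectively; their sum 8 and the factor 2 in \<open>A\<close> give 16.\<close>

lemma near_boundary_estimate:
  assumes f: "quasiregular_harmonic_on (ball 0 1) k f" and cont: "continuous_on (cball 0 1) f"
    and k: "0 < k" "k < 1" and \<delta>: "0 < \<delta>"
    and z: "norm z \<le> 1" "1 - \<delta> \<le> norm z" and w: "norm w \<le> 1" "norm (z - w) \<le> \<delta>"
  defines "p \<equiv> 4 * k / (1 + k)\<^sup>2"
  shows "norm (f z - f w) \<le> 16 * (1 / cos (p * pi / 2)) powr (1 / p) * boundary_modulus f \<delta>"
proof -
  define A where "A = 2 * (1 / cos (p * pi / 2)) powr (1 / p) * boundary_modulus f \<delta>"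
  have A: "0 \<le> A" unfolding A_def using boundary_modulus_nonneg[OF cont, of \<delta>] \<delta> by simp
  obtain \<zeta> where \<zeta>: "norm \<zeta> = 1" "norm (z - \<zeta>) \<le> \<delta>"
  \<comment> \<open>The origin has no radial projection, but then \<delta> is at least 1 and any
    boundary point serves.\<close>
  proof (cases "z = 0")
    case True
    then show ?thesis using that[of 1] z by simp
  next
    case False
    have "z - sgn z = of_real (norm z - 1) * sgn z"
      using False by (simp add: sgn_eq field_simps)
    then have "norm (z - sgn z) = 1 - norm z"
      using z False by (simp only: norm_mult norm_of_real) (simp add: norm_sgn)
    then show ?thesis using that[of "sgn z"] z False by (simp add: norm_sgn)
  qed
  have near: "norm (f v - f \<zeta>) \<le> A * 5" if "norm v \<le> 1" "norm (v - \<zeta>) \<le> 2 * \<delta>" for v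
  proof -
    have "norm (f v - f \<zeta>) \<le> A * (1 + 2 * norm (v - \<zeta>) / \<delta>)"
      unfolding A_def p_def by (rule interior_boundary_estimate[OF f cont k \<delta> \<zeta>(1) that(1)])
    also have "\<dots> \<le> A * 5" using that(2) \<delta> A by (intro mult_left_mono) (auto simp: field_simps)
    finally show ?thesis .
  qed
  have near': "norm (f z - f \<zeta>) \<le> A * 3"
  proof -
    have "norm (f z - f \<zeta>) \<le> A * (1 + 2 * norm (z - \<zeta>) / \<delta>)"
      unfolding A_def p_def by (rule interior_boundary_estimate[OF f cont k \<delta> \<zeta>(1) z(1)])
    also have "\<dots> \<le> A * 3" using \<zeta>(2) \<delta> A by (intro mult_left_mono) (auto simp: field_simps)
    finally show ?thesis .
  qed
  have "norm (w - \<zeta>) \<le> 2 * \<delta>"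
    using norm_triangle_ineq[of "w - z" "z - \<zeta>"] w(2) \<zeta>(2) by (simp add: norm_minus_commute)
  then have "norm (f w - f \<zeta>) \<le> A * 5" using near w by blast
  then have "norm (f z - f w) \<le> A * 8"
    using norm_triangle_ineq4[of "f z - f \<zeta>" "f w - f \<zeta>"] near' by simp
  then show ?thesis by (simp add: A_def)
qed

text \<open>For \<open>z\<close> deep inside, the step \<open>h\<close> is frozen. On the circle of
  radius \<open>1 - \<delta>\<close> the previous lemma bounds \<open>g\<close>, and the maximum
  principle carries the bound inward. Quasiregularity need not pass to \<open>g\<close>; harmonicity
  suffices, as \<open>(norm (g v))\<^sup>2\<close> is subharmonic.\<close>

lemma disk_difference_estimate:
  assumes f: "quasiregular_harmonic_on (ball 0 1) k f" and cont: "continuous_on (cball 0 1) f"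
    and k: "0 < k" "k < 1" and \<delta>: "0 < \<delta>"
    and z: "norm z \<le> 1" and w: "norm w \<le> 1" and zw: "norm (z - w) \<le> \<delta>"
  defines "p \<equiv> 4 * k / (1 + k)\<^sup>2"
  shows "norm (f z - f w) \<le> 16 * (1 / cos (p * pi / 2)) powr (1 / p) * boundary_modulus f \<delta>"
proof (cases "1 - \<delta> \<le> norm z")
  case True
  then show ?thesis unfolding p_def using near_boundary_estimate[OF f cont k \<delta> z _ w zw] by blast
next
  case False
  define B where "B = 16 * (1 / cos (p * pi / 2)) powr (1 / p) * boundary_modulus f \<delta>"
  have B: "0 \<le> B" unfolding B_def using boundary_modulus_nonneg[OF cont, of \<delta>] \<delta> by simp
  define R where "R = 1 - \<delta>"
  have R: "0 < R" using False norm_ge_zero[of z] unfolding R_def by linarith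
  define h where "h = w - z"
  have h: "norm h \<le> \<delta>" using zw by (simp add: h_def norm_minus_commute)
  define g where "g v = f (v + h) - f v" for v
  have mem: "norm (v + h) \<le> 1" "norm v \<le> 1" if "norm v \<le> R" for v
    using norm_triangle_ineq[of v h] h that \<delta> unfolding R_def by linarith+
  have mem': "norm (v + h) < 1" "norm v < 1" if "norm v < R" for v
    using norm_triangle_ineq[of v h] h that \<delta> unfolding R_def by linarith+
  have harm: "harmonic_on (ball 0 1) f" using f by (simp add: quasiregular_harmonic_on_def)
  \<comment> \<open>The power 1 casts the squared norm in the form of
    \<open>laplacian_nonneg_at_norm_powr\<close> with \<open>q = 1\<close>, where the left side of
    its inequality vanishes.\<close>
  define \<phi> where "\<phi> v = ((norm (g v))\<^sup>2) powr 1 + - (B\<^sup>2)" for v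
  have "\<phi> z \<le> 0"
  proof (rule maximum_principle[of "ball 0 R"])
    have "continuous_on (cball 0 R) g"
      unfolding g_def using mem
      by (intro continuous_intros continuous_on_compose2[OF cont]) auto
    then show "continuous_on (closure (ball 0 R)) \<phi>"
      unfolding \<phi>_def using R by (auto intro!: continuous_intros)
    show "z \<in> closure (ball 0 R)" using False R by (simp add: R_def)
  next
    fix v :: complex assume "v \<in> frontier (ball 0 R)"
    then have v: "norm v = R" using R by (simp add: dist_norm)
    have "norm (f v - f (v + h)) \<le> B"
      unfolding B_def p_def using v mem[of v] h
      by (intro near_boundary_estimate[OF f cont k \<delta>]) (auto simp: R_def)
    then have "norm (g v) \<le> B" by (simp add: g_def norm_minus_commute)
    then show "\<phi> v \<le> 0" by (simp add: \<phi>_def power_mono)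
  next
    fix v :: complex assume v: "v \<in> ball 0 R" and pos: "\<phi> v > 0"
    have "g v \<noteq> 0" using pos by (auto simp: \<phi>_def)
    have "v + h \<in> ball 0 1" "v \<in> ball 0 1" using mem'[of v] v by simp_all
    from harmonic_at_diff[OF harmonic_at_translate[OF harmonic_on_imp_harmonic_at[OF harm _ this(1)]]
        harmonic_on_imp_harmonic_at[OF harm _ this(2)]]
    have g: "harmonic_at g v (partial_x f (v + h) - partial_x f v)
        (partial_y f (v + h) - partial_y f v)"
      unfolding g_def by simp
    show "laplacian_nonneg_at \<phi> v"
      unfolding \<phi>_def
      by (intro laplacian_nonneg_at_add laplacian_nonneg_at_const
          laplacian_nonneg_at_norm_powr[OF g \<open>g v \<noteq> 0\<close>]) simp_all
  qed simp_all
  then have "(norm (g z))\<^sup>2 \<le> B\<^sup>2" by (simp add: \<phi>_def)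
  then have "norm (g z) \<le> B" using B by (rule power2_le_imp_le)
  then show ?thesis by (simp add: g_def h_def B_def norm_minus_commute)
qed

theorem theorem2p1:
  fixes k :: real
  assumes "0 < k" and "k < 1"
  shows "\<exists>C::real. \<forall>f :: complex \<Rightarrow> complex.
           quasiregular_harmonic_on (ball 0 1) k f \<and> continuous_on (cball 0 1) f \<longrightarrow>
           (\<forall>\<delta>\<ge>0. disk_modulus f \<delta> \<le> C * boundary_modulus f \<delta>)"
proof (intro exI allI impI)
  fix f :: "complex \<Rightarrow> complex" and \<delta> :: real
  assume f: "quasiregular_harmonic_on (ball 0 1) k f \<and> continuous_on (cball 0 1) f"
    and \<delta>: "0 \<le> \<delta>"
  define p where "p = 4 * k / (1 + k)\<^sup>2"
  have "norm (f z - f w) \<le> 16 * (1 / cos (p * pi / 2)) powr (1 / p) * boundary_modulus f \<delta>"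
    if "norm z \<le> 1" "norm w \<le> 1" "norm (z - w) \<le> \<delta>" for z w
  \<comment> \<open>The barrier divides by \<delta>, so \<delta> = 0 is separate; there
    \<open>z = w\<close>.\<close>
  proof (cases "\<delta> = 0")
    case True
    then show ?thesis using that boundary_modulus_nonneg[of f \<delta>] f by simp
  next
    case False
    then show ?thesis
      unfolding p_def using disk_difference_estimate[of k f \<delta> z w] assms f \<delta> that by simp
  qed
  \<comment> \<open>This fixes the witness for \<open>C\<close>. It is written out in
    \<open>k\<close> alone, since it must not depend on \<open>f\<close> or \<delta>. The pair
    \<open>z = w = 0\<close> shows that the set under the supremum is nonempty.\<close>
  then show "disk_modulus f \<delta> \<le>
      16 * (1 / cos ((4 * k / (1 + k)\<^sup>2) * pi / 2)) powr (1 / (4 * k / (1 + k)\<^sup>2))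
        * boundary_modulus f \<delta>"
    unfolding disk_modulus_def p_def using \<delta>
    by (intro cSup_least) (auto intro!: exI[of _ 0])
qed

end
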